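(* Let $k \geq 2$ and let $H=(V,E)$ be a finite $k$-uniform sequence hypergraph with $\Delta(H) \leq \Delta$ and $I(H)=I$, whose every vertex is equipped with a list of at least $R$ colors. Let $\Pi$ be a set of permutations of $\{1,\dots,k\}$ such that $\sigma\in\Pi$ implies $\sigma^{-1}\in\Pi$, and let $\pi := |\Pi|$. Define $q_1:=1$ and $q_i:= \frac{i}{i-1}\sqrt[i]{i-1}$ for every $i > 1$. If $$R \geq 1+\left\lfloor \sum_{i \in I} q_i \sqrt[i]{\Delta(\Delta-1)\pi \left(1+ (k-1)\min \left\{1, \frac{|I|}{k-i} \right\}\right)}\right\rfloor,$$ then there exists a list $\Pi$-distinguishing coloring of $H$.
   Context: A sequence hypergraph is a hypergraph in which each edge is given as a sequence $(v_1,\dots,v_k)$ of its (distinct) vertices; orderings of different edges are independent. For a vertex $v$, $\deg v$ is the number of edges containing $v$ and $\Delta(H)=\max_v\deg v$. $I(H):=\{|P\setminus Q| : P,Q\in E\}\cap\{1,\dots,k-1\}$ (edges viewed as sets). Two sequences $B=(b_1,\dots,b_k)$ and $D=(d_1,\dots,d_k)$ are $\Pi$-compatible if there is $\sigma\in\Pi$ with $(b_{\sigma(1)},\dots,b_{\sigma(k)})=D$. A vertex coloring $\varphi$ is $\Pi$-distinguishing if for any two distinct intersecting edges $P=(p_1,\dots,p_k)$ and $Q=(q_1,\dots,q_k)$, the color sequences $(\varphi(p_1),\dots,\varphi(p_k))$ and $(\varphi(q_1),\dots,\varphi(q_k))$ are not $\Pi$-compatible. A list coloring assigns to each vertex a color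 from its list. *)

theory Defs
  imports Complex_Main "HOL-Combinatorics.Permutations"
begin

text \<open>
  Edges are vertex sets, and \<open>s P\<close> enumerates the edge \<open>P\<close> as the sequence
  \<open>s P 1, \<dots>, s P (card P)\<close>.  In particular there is exactly one ordering per
  edge, so no two edges have the same vertex set.  Values of \<open>s P\<close> outside
  \<open>{1..card P}\<close> are irrelevant.
\<close>

definition sequence_hypergraph :: "'a set \<Rightarrow> 'a set set \<Rightarrow> ('a set \<Rightarrow> nat \<Rightarrow> 'a) \<Rightarrow> bool" where
  "sequence_hypergraph V E s \<longleftrightarrow>
     (\<forall>P\<in>E. P \<subseteq> V) \<and> (\<forall>P\<in>E. bij_betw (s P) {1..card P} P)"

definition uniform :: "nat \<Rightarrow> 'a set set \<Rightarrow> bool" where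
  "uniform k E \<longleftrightarrow> (\<forall>P\<in>E. card P = k)"

definition degree :: "'a set set \<Rightarrow> 'a \<Rightarrow> nat" where
  "degree E v = card {P \<in> E. v \<in> P}"

text \<open>The inserted \<open>0\<close> only matters for an empty vertex set.\<close>

definition max_degree :: "'a set \<Rightarrow> 'a set set \<Rightarrow> nat" where
  "max_degree V E = Max (insert 0 (degree E ` V))"

definition diff_sizes :: "nat \<Rightarrow> 'a set set \<Rightarrow> nat set" where
  "diff_sizes k E = {card (P - Q) | P Q. P \<in> E \<and> Q \<in> E} \<inter> {1..k - 1}"

text \<open>Sequences of length \<open>k\<close> are functions on \<open>nat\<close> restricted to the indices \<open>1, \<dots>, k\<close>.\<close>

definition compatible :: "nat \<Rightarrow> (nat \<Rightarrow> nat) set \<Rightarrow> (nat \<Rightarrow> 'c) \<Rightarrow> (nat \<Rightarrow> 'c) \<Rightarrow> bool" where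
  "compatible k \<P> b d \<longleftrightarrow> (\<exists>\<sigma>\<in>\<P>. \<forall>j\<in>{1..k}. b (\<sigma> j) = d j)"

definition distinguishing ::
  "nat \<Rightarrow> (nat \<Rightarrow> nat) set \<Rightarrow> 'a set set \<Rightarrow> ('a set \<Rightarrow> nat \<Rightarrow> 'a) \<Rightarrow> ('a \<Rightarrow> 'c) \<Rightarrow> bool" where
  "distinguishing k \<P> E s \<phi> \<longleftrightarrow>
     (\<forall>P\<in>E. \<forall>Q\<in>E. P \<noteq> Q \<longrightarrow> P \<inter> Q \<noteq> {} \<longrightarrow>
        \<not> compatible k \<P> (\<lambda>j. \<phi> (s P j)) (\<lambda>j. \<phi> (s Q j)))"

definition list_coloring :: "'a set \<Rightarrow> ('a \<Rightarrow> 'c set) \<Rightarrow> ('a \<Rightarrow> 'c) \<Rightarrow> bool" where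
  "list_coloring V L \<phi> \<longleftrightarrow> (\<forall>v\<in>V. \<phi> v \<in> L v)"

definition q :: "nat \<Rightarrow> real" where
  "q i = (if i = 1 then 1 else real i / (real i - 1) * root i (real i - 1))"

end

theory Submission
  imports Defs
begin

text \<open>
  Rosenfeld's counting method, with conflict-freeness defined for partial colorings as well: every
  newly colored vertex multiplies the number of conflict-free colorings by at least some fixed
  \<open>\<beta> > 0\<close>.  Let a conflict of \<open>P\<close> and \<open>Q\<close> with \<open>|P - Q| = i\<close> be completed by coloring \<open>v\<close>.  Then
  some \<open>i\<close> colored vertices, \<open>v\<close> among them, have colors determined by the other ones, so by
  induction the number of extensions to \<open>v\<close> having this conflict is at most \<open>1 / \<beta> ^ (i - 1)\<close> times
  the number of conflict-free colorings without \<open>v\<close>.  At most \<open>\<Delta> (\<Delta> - 1) |\<P>| k / (k - i) \<le> A i\<close> conflicts with parameter \<open>i\<close>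
  involve \<open>v\<close>, where \<open>A i\<close> is the radicand of the theorem.  So it suffices that
  \<open>\<beta> + (\<Sum>i\<in>I. A i / \<beta> ^ (i - 1)) \<le> R\<close>.  The single function \<open>\<beta> + A i / \<beta> ^ (i - 1)\<close> has infimum
  \<open>q i * root i (A i)\<close>, attained (for \<open>i > 1\<close>, \<open>A i > 0\<close>) at \<open>root i ((i - 1) * A i)\<close>; take \<open>\<beta>\<close> to be
  the sum of these points plus the slack in the hypothesis on \<open>R\<close>.
\<close>

section \<open>Choice of the growth rate\<close>

text \<open>With \<open>r\<close> the root on the left, \<open>A = r ^ i / (i - 1)\<close> for
  \<open>i > 1\<close>, so \<open>b \<ge> r\<close> gives
  \<open>A / b ^ (i - 1) \<le> r / (i - 1)\<close>. Having \<open>r\<close> and not \<open>b\<close>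
  as the first summand lets a single \<open>b\<close> serve all \<open>i\<close> at once.\<close>

lemma q_root_bound:
  fixes A b :: real
  assumes i: "1 \<le> i" and A: "0 \<le> A" and b: "0 < b" "root i ((real i - 1) * A) \<le> b"
  shows "root i ((real i - 1) * A) + A * (1 / b) ^ (i - 1) \<le> q i * root i A"
proof (cases "i = 1")
  case False
  then have i2: "2 \<le> i" using i by simp
  define r where "r = root i ((real i - 1) * A)"
  have r0: "0 \<le> r" using i2 A by (simp add: r_def)
  have "r ^ i = (real i - 1) * A"
    unfolding r_def using i2 A by (intro real_root_pow_pos2) auto
  then have "A = r ^ i / (real i - 1)" using i2 by (simp add: field_simps)
  moreover have "r ^ i = r * r ^ (i - 1)" using i2 by (metis power_eq_if not_numeral_le_zero)
  moreover have "(r / b) ^ (i - 1) \<le> 1"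
    using b r0 by (intro power_le_one) (auto simp: r_def)
  ultimately have "A * (1 / b) ^ (i - 1) \<le> r / (real i - 1)"
    using i2 r0 b(1) mult_left_le[of "(r / b) ^ (i - 1)" "r / (real i - 1)"]
    by (simp add: power_divide)
  moreover have "r + r / (real i - 1) = q i * root i A"
  proof -
    have "r + r / (real i - 1) = real i / (real i - 1) * r"
      using i2 by (simp add: field_simps)
    then show ?thesis
      using False by (simp add: q_def r_def real_root_mult)
  qed
  ultimately show ?thesis by (simp add: r_def)
qed (simp add: q_def)

lemma growth_rate_exists:
  fixes A :: "nat \<Rightarrow> real" and R :: real
  assumes fin: "finite I" and I: "\<And>i. i \<in> I \<Longrightarrow> 1 \<le> i" and A: "\<And>i. i \<in> I \<Longrightarrow> 0 \<le> A i"
    and R: "(\<Sum>i\<in>I. q i * root i (A i)) < R"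
  shows "\<exists>\<beta>>0. \<beta> + (\<Sum>i\<in>I. A i * (1 / \<beta>) ^ (i - 1)) \<le> R"
proof -
  define b where "b i = root i ((real i - 1) * A i)" for i
  \<comment> \<open>The slack keeps \<open>\<beta>\<close> positive even if every \<open>b i\<close>
    vanishes.\<close>
  define \<delta> where "\<delta> = R - (\<Sum>i\<in>I. q i * root i (A i))"
  define \<beta> where "\<beta> = \<delta> + sum b I"
  have b0: "0 \<le> b i" if "i \<in> I" for i
    using I[OF that] A[OF that] by (simp add: b_def)
  have \<delta>: "0 < \<delta>" using R by (simp add: \<delta>_def)
  have \<beta>: "0 < \<beta>" using \<delta> b0 sum_nonneg[of I b] by (simp add: \<beta>_def)
  have "b i + A i * (1 / \<beta>) ^ (i - 1) \<le> q i * root i (A i)" if "i \<in> I" for i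
  proof -
    have "b i \<le> sum b I" using fin that b0 by (intro member_le_sum) auto
    then have "b i \<le> \<beta>" using \<delta> by (simp add: \<beta>_def)
    then show ?thesis using q_root_bound[of i "A i" \<beta>] I A that \<beta> by (simp add: b_def)
  qed
  then have "(\<Sum>i\<in>I. b i + A i * (1 / \<beta>) ^ (i - 1)) \<le> (\<Sum>i\<in>I. q i * root i (A i))"
    by (rule sum_mono)
  then have "\<beta> + (\<Sum>i\<in>I. A i * (1 / \<beta>) ^ (i - 1)) \<le> R"
    by (simp add: \<beta>_def \<delta>_def sum.distrib)
  then show ?thesis using \<beta> by blast
qed

section \<open>Partial colorings and their conflicts\<close>

text \<open>By \<open>det\<close> the values on \<open>Y\<close> determine those on
  \<open>X - Y\<close>, so restriction to \<open>Y\<close> is injective on \<open>A\<close>.\<close>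

lemma card_le_of_restrict_eqD:
  assumes fin: "finite B"
    and sub: "(\<lambda>c. restrict c Y) ` A \<subseteq> B"
    and ext: "A \<subseteq> extensional X"
    and det: "\<And>c d u. c \<in> A \<Longrightarrow> d \<in> A \<Longrightarrow> (\<And>y. y \<in> Y \<Longrightarrow> c y = d y) \<Longrightarrow> u \<in> X - Y \<Longrightarrow> c u = d u"
  shows "card A \<le> card B"
proof (rule card_inj_on_le[OF _ sub fin], rule inj_onI)
  fix c d assume cd: "c \<in> A" "d \<in> A" "restrict c Y = restrict d Y"
  then have Y: "c y = d y" if "y \<in> Y" for y using that by (metis restrict_apply')
  show "c = d"
  proof (rule extensionalityI)
    show "c \<in> extensional X" "d \<in> extensional X" using cd ext by auto
    show "c u = d u" if "u \<in> X" for u using det[OF cd(1,2) Y, of u] Y that by blast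
  qed
qed

locale list_sequence_hypergraph =
  fixes V :: "'a set" and E :: "'a set set" and s :: "'a set \<Rightarrow> nat \<Rightarrow> 'a"
    and L :: "'a \<Rightarrow> 'c set" and \<P> :: "(nat \<Rightarrow> nat) set" and k \<Delta> R :: nat
  assumes finite_V: "finite V"
    and edge_subset: "\<And>P. P \<in> E \<Longrightarrow> P \<subseteq> V"
    and enum: "\<And>P. P \<in> E \<Longrightarrow> bij_betw (s P) {1..k} P"
    and degree_le: "\<And>v. v \<in> V \<Longrightarrow> card {P \<in> E. v \<in> P} \<le> \<Delta>"
    and finite_L: "\<And>v. v \<in> V \<Longrightarrow> finite (L v)"
    and card_L: "\<And>v. v \<in> V \<Longrightarrow> card (L v) = R"
    and perm: "\<And>\<sigma>. \<sigma> \<in> \<P> \<Longrightarrow> \<sigma> permutes {1..k}"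
    and inv_perm: "\<And>\<sigma>. \<sigma> \<in> \<P> \<Longrightarrow> inv \<sigma> \<in> \<P>"
begin

lemma finite_E: "finite E"
  using finite_V edge_subset by (meson Pow_iff finite_Pow_iff finite_subset subsetI)

lemma finite_edge: "P \<in> E \<Longrightarrow> finite P"
  using finite_V edge_subset finite_subset by blast

lemma card_edge: "P \<in> E \<Longrightarrow> card P = k"
  using bij_betw_same_card[OF enum] by simp

lemma finite_perms: "finite \<P>"
  using perm by (intro finite_subset[OF _ finite_permutations[of "{1..k}"]]) auto

text \<open>
  Constraints between a vertex and itself are ignored, even outside \<open>X\<close>: otherwise coloring
  a vertex that \<open>\<sigma>\<close> fixes could complete a conflict without being determined by the
  remaining colors.
\<close>

definition conflict :: "'a set \<Rightarrow> ('a \<Rightarrow> 'c) \<Rightarrow> 'a set \<Rightarrow> 'a set \<Rightarrow> (nat \<Rightarrow> nat) \<Rightarrow> bool" where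
  "conflict X c P Q \<sigma> \<longleftrightarrow>
     (\<forall>j\<in>{1..k}. s P (\<sigma> j) = s Q j \<or>
        s P (\<sigma> j) \<in> X \<and> s Q j \<in> X \<and> c (s P (\<sigma> j)) = c (s Q j))"

definition triples :: "('a set \<times> 'a set \<times> (nat \<Rightarrow> nat)) set" where
  "triples = {(P, Q, \<sigma>). P \<in> E \<and> Q \<in> E \<and> \<sigma> \<in> \<P> \<and> P \<noteq> Q \<and> P \<inter> Q \<noteq> {}}"

text \<open>Partial colorings are extensional, so that they can be counted and a restriction is
  literally an element of the smaller set.\<close>

definition good :: "'a set \<Rightarrow> ('a \<Rightarrow> 'c) set" where
  "good X = {c \<in> PiE X L. \<forall>(P, Q, \<sigma>)\<in>triples. \<not> conflict X c P Q \<sigma>}"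

lemma finite_triples: "finite triples"
  by (rule finite_subset[of _ "E \<times> E \<times> \<P>"])
    (auto simp: triples_def finite_E finite_perms)

text \<open>Closure under inverses lets the two edges of a conflict trade places. Hence only triples
  with the new vertex in the first edge have to be counted, which saves a factor 2.\<close>

lemma triples_sym: "(P, Q, \<sigma>) \<in> triples \<Longrightarrow> (Q, P, inv \<sigma>) \<in> triples"
  using inv_perm by (auto simp: triples_def)

lemma conflict_sym:
  assumes "\<sigma> \<in> \<P>" "conflict X c P Q \<sigma>"
  shows "conflict X c Q P (inv \<sigma>)"
  unfolding conflict_def
proof
  fix j assume "j \<in> {1..k}"
  then have "inv \<sigma> j \<in> {1..k}" "\<sigma> (inv \<sigma> j) = j"
    using perm[OF assms(1)] permutes_inv permutes_in_image permutes_inverses(1) by metis+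
  then show "s Q (inv \<sigma> j) = s P j \<or>
      s Q (inv \<sigma> j) \<in> X \<and> s P j \<in> X \<and> c (s Q (inv \<sigma> j)) = c (s P j)"
    using assms(2) unfolding conflict_def by (metis (no_types))
qed

lemma finite_PiE_L: "X \<subseteq> V \<Longrightarrow> finite (PiE X L)"
  using finite_V finite_L by (intro finite_PiE) (auto intro: finite_subset)

lemma finite_good: "X \<subseteq> V \<Longrightarrow> finite (good X)"
  using finite_PiE_L by (simp add: good_def)

lemma conflict_restrictD:
  "conflict X (restrict c X) P Q \<sigma> \<Longrightarrow> X \<subseteq> Y \<Longrightarrow> conflict Y c P Q \<sigma>"
  unfolding conflict_def by (metis in_mono restrict_apply')

lemma restrict_good:
  assumes "c \<in> good Y" "X \<subseteq> Y"
  shows "restrict c X \<in> good X"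
  using assms conflict_restrictD[of X c _ _ _ Y] by (fastforce simp: good_def)

lemma card_edge_diff:
  assumes t: "(P, Q, \<sigma>) \<in> triples"
  shows "card (P - Q) \<in> {1..k - 1}" "card (P \<inter> Q) = k - card (P - Q)"
proof -
  have PQ: "P \<in> E" "Q \<in> E" "P \<noteq> Q" "P \<inter> Q \<noteq> {}" using t by (auto simp: triples_def)
  have fin: "finite P" "finite Q" using PQ finite_edge by auto
  have sum: "card (P \<inter> Q) + card (P - Q) = k"
    using fin card_edge[OF PQ(1)] by (metis card_Int_Diff)
  have "card (P \<inter> Q) > 0" using PQ fin by (simp add: card_gt_0_iff)
  moreover have "P - Q \<noteq> {}"
    using PQ card_edge fin card_subset_eq[of Q P] by auto
  then have "card (P - Q) > 0" using fin by (simp add: card_gt_0_iff)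
  ultimately show "card (P - Q) \<in> {1..k - 1}" "card (P \<inter> Q) = k - card (P - Q)"
    using sum by auto
qed

section \<open>Conflicts completed by one new vertex\<close>

text \<open>The last condition puts \<open>v\<close> on the side of \<open>P\<close> and matches it
  with another vertex, whose color then fixes that of \<open>v\<close>.\<close>

definition bad :: "'a set \<Rightarrow> 'a \<Rightarrow> 'a set \<Rightarrow> 'a set \<Rightarrow> (nat \<Rightarrow> nat) \<Rightarrow> ('a \<Rightarrow> 'c) set" where
  "bad X v P Q \<sigma> = {c \<in> PiE (insert v X) L. restrict c X \<in> good X \<and> conflict (insert v X) c P Q \<sigma> \<and>
     (\<exists>j\<in>{1..k}. s P (\<sigma> j) = v \<and> s Q j \<noteq> v)}"

text \<open>
  The conflict matches every vertex \<open>u\<close> of \<open>P\<close> with an equally colored vertex \<open>u'\<close> of \<open>Q\<close>.  As \<open>v' \<noteq> v\<close>, the vertex \<open>v'\<close> is outside \<open>insert v (P - Q)\<close>; and for \<open>u \<in> P - Q\<close> either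
  \<open>u' = v\<close> or \<open>u'\<close> is outside as well.  So the colors on \<open>insert v (P - Q)\<close> are
  determined by the others.
\<close>

lemma card_bad_le:
  assumes XV: "insert v X \<subseteq> V" and vX: "v \<notin> X" and t: "(P, Q, \<sigma>) \<in> triples"
    and ne: "bad X v P Q \<sigma> \<noteq> {}"
  shows "\<exists>Z\<subseteq>X. card Z = card (P - Q) - 1 \<and> card (bad X v P Q \<sigma>) \<le> card (good (X - Z))"
proof -
  have PQ: "P \<in> E" "Q \<in> E" "\<sigma> \<in> \<P>" using t by (auto simp: triples_def)
  have bP: "bij_betw (s P) {1..k} P" and bQ: "bij_betw (s Q) {1..k} Q" using PQ enum by auto
  have \<sigma>: "\<sigma> ` {1..k} = {1..k}" using perm[OF PQ(3)] by (rule permutes_image)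
  have sQ: "s Q j \<in> Q" if "j \<in> {1..k}" for j using bQ that by (rule bij_betwE[rule_format])
  have match: "\<exists>j\<in>{1..k}. s P (\<sigma> j) = u" if "u \<in> P" for u
    using bij_betw_imp_surj_on[OF bP] \<sigma> that by (metis imageE)
  obtain c0 j0 where c0: "conflict (insert v X) c0 P Q \<sigma>"
    and j0: "j0 \<in> {1..k}" "s P (\<sigma> j0) = v" "s Q j0 \<noteq> v"
    using ne by (auto simp: bad_def)
  have fin: "finite (P - Q)" using PQ finite_edge by auto
  \<comment> \<open>A vertex of \<open>P - Q\<close> cannot be matched with itself, so the conflict
    requires it to be colored.\<close>
  have "P - Q \<subseteq> insert v X"
  proof
    fix u assume u: "u \<in> P - Q"
    then obtain j where "j \<in> {1..k}" "s P (\<sigma> j) = u" using match by blast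
    then show "u \<in> insert v X" using u sQ c0 unfolding conflict_def by (metis DiffD2)
  qed
  then have sub: "P - Q - {v} \<subseteq> X" by auto
  have "card (P - Q) - 1 \<le> card (P - Q - {v})"
    using fin diff_card_le_card_Diff[of "{v}" "P - Q"] by simp
  \<comment> \<open>If \<open>v\<close> lies in \<open>Q\<close>, then \<open>P - Q - {v}\<close>
    has one vertex too many, which stays among the colored ones. In either case
    \<open>insert v Z\<close> has exactly \<open>card (P - Q)\<close> elements.\<close>
  then obtain Z where Z: "Z \<subseteq> P - Q - {v}" "card Z = card (P - Q) - 1"
    by (meson obtain_subset_with_card_n)
  have "card (bad X v P Q \<sigma>) \<le> card (good (X - Z))"
  proof (rule card_le_of_restrict_eqD[where Y = "X - Z" and X = "insert v X"])
    show "finite (good (X - Z))" using XV by (intro finite_good) auto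
    have "restrict (restrict c X) (X - Z) \<in> good (X - Z)" if "c \<in> bad X v P Q \<sigma>" for c
      using that restrict_good[of "restrict c X" X "X - Z"] by (auto simp: bad_def)
    moreover have "restrict (restrict c X) (X - Z) = restrict c (X - Z)" for c :: "'a \<Rightarrow> 'c"
      by (auto simp: restrict_def)
    ultimately show "(\<lambda>c. restrict c (X - Z)) ` bad X v P Q \<sigma> \<subseteq> good (X - Z)" by auto
    show "bad X v P Q \<sigma> \<subseteq> extensional (insert v X)" by (auto simp: bad_def PiE_def)
    fix c d u
    assume cd: "c \<in> bad X v P Q \<sigma>" "d \<in> bad X v P Q \<sigma>"
      and eq: "\<And>y. y \<in> X - Z \<Longrightarrow> c y = d y" and u: "u \<in> insert v X - (X - Z)"
    have cf: "conflict (insert v X) c P Q \<sigma>" "conflict (insert v X) d P Q \<sigma>"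
      using cd by (auto simp: bad_def)
    have "s Q j0 \<in> X - Z"
      using sQ j0 c0 Z(1) unfolding conflict_def
      by (metis DiffD1 DiffD2 DiffI insertE subsetD)
    then have "c (s Q j0) = d (s Q j0)" by (rule eq)
    then have v: "c v = d v" using cf j0 unfolding conflict_def by metis
    show "c u = d u"
    proof (cases "u = v")
      case False
      then have uZ: "u \<in> Z" using u by auto
      then obtain j where j: "j \<in> {1..k}" "s P (\<sigma> j) = u" using Z match by blast
      have ne: "s Q j \<noteq> u" and nZ: "s Q j \<notin> Z" using sQ[OF j(1)] uZ Z by auto
      then have "s Q j \<in> insert v X" using j c0 unfolding conflict_def by metis
      then have "c (s Q j) = d (s Q j)" using v eq nZ by auto
      then show ?thesis using cf j ne unfolding conflict_def by metis
    qed (use v in simp)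
  qed
  then show ?thesis using Z sub by blast
qed

definition triples_at :: "'a \<Rightarrow> ('a set \<times> 'a set \<times> (nat \<Rightarrow> nat)) set" where
  "triples_at v = {(P, Q, \<sigma>) \<in> triples. v \<in> P}"

lemma finite_triples_at: "finite (triples_at v)"
  using finite_triples by (rule finite_subset[rotated]) (auto simp: triples_at_def)

text \<open>Restricting to \<open>X\<close> destroys the conflict, so some position matches two
  different vertices one of which is \<open>v\<close>. If \<open>v\<close> is on the side of
  \<open>Q\<close> there, swap the edges and invert \<open>\<sigma>\<close>.\<close>

lemma extension_good_or_bad:
  assumes c: "c \<in> PiE (insert v X) L" "restrict c X \<in> good X" and ng: "c \<notin> good (insert v X)"
  shows "\<exists>(P, Q, \<sigma>)\<in>triples_at v. c \<in> bad X v P Q \<sigma>"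
proof -
  obtain P Q \<sigma> where t: "(P, Q, \<sigma>) \<in> triples" and cf: "conflict (insert v X) c P Q \<sigma>"
    using c ng by (auto simp: good_def)
  have "\<not> conflict X (restrict c X) P Q \<sigma>" using c t by (auto simp: good_def)
  then obtain j where j: "j \<in> {1..k}" "s P (\<sigma> j) \<noteq> s Q j" "s P (\<sigma> j) = v \<or> s Q j = v"
    using cf unfolding conflict_def by (metis insertE restrict_apply')
  have \<sigma>: "\<sigma> \<in> \<P>" "P \<in> E" "Q \<in> E" using t by (auto simp: triples_def)
  have \<sigma>j: "\<sigma> j \<in> {1..k}" "inv \<sigma> (\<sigma> j) = j"
    using perm[OF \<sigma>(1)] j permutes_in_image permutes_inverses(2) by metis+
  from j(3) show ?thesis
  proof
    assume v: "s P (\<sigma> j) = v"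
    then have "v \<in> P" using enum[OF \<sigma>(2)] \<sigma>j by (metis bij_betwE)
    moreover have "c \<in> bad X v P Q \<sigma>" using c cf j v by (auto simp: bad_def)
    ultimately show ?thesis using t by (auto simp: triples_at_def)
  next
    assume v: "s Q j = v"
    then have "v \<in> Q" using enum[OF \<sigma>(3)] j by (metis bij_betwE)
    then have "(Q, P, inv \<sigma>) \<in> triples_at v" using triples_sym[OF t] by (simp add: triples_at_def)
    moreover have "c \<in> bad X v Q P (inv \<sigma>)"
      using c conflict_sym[OF \<sigma>(1) cf] \<sigma>j v j unfolding bad_def by (auto intro!: bexI[of _ "\<sigma> j"])
    ultimately show ?thesis by blast
  qed
qed

section \<open>Growth of the number of conflict-free colorings\<close>

lemma card_extensions:
  assumes "insert v X \<subseteq> V" "v \<notin> X"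
  shows "card {c \<in> PiE (insert v X) L. restrict c X \<in> good X} = R * card (good X)"
proof -
  have "bij_betw (\<lambda>(y, g). g(v := y)) (L v \<times> good X) {c \<in> PiE (insert v X) L. restrict c X \<in> good X}"
  proof (rule bij_betw_imageI)
    show "inj_on (\<lambda>(y, g). g(v := y)) (L v \<times> good X)"
    proof (rule inj_onI, clarify)
      fix y g y' g'
      assume g: "g \<in> good X" "g' \<in> good X" and eq: "g(v := y) = g'(v := y')"
      \<comment> \<open>As \<open>v\<close> is outside \<open>X\<close>, resetting it to the default
        value recovers \<open>g\<close> from the extension.\<close>
      have "g v = undefined" "g' v = undefined"
        using g assms(2) by (auto simp: good_def PiE_def extensional_def)
      then show "y = y' \<and> g = g'" using eq by (metis fun_upd_same fun_upd_triv fun_upd_upd)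
    qed
    have upd: "restrict (g(v := y)) X = g" if "g \<in> good X" for g y
      using that assms(2) by (auto simp: good_def PiE_def extensional_def restrict_def)
    show "(\<lambda>(y, g). g(v := y)) ` (L v \<times> good X) = {c \<in> PiE (insert v X) L. restrict c X \<in> good X}"
    proof (intro equalityI subsetI)
      fix c assume "c \<in> (\<lambda>(y, g). g(v := y)) ` (L v \<times> good X)"
      then obtain y g where yg: "y \<in> L v" "g \<in> good X" "c = g(v := y)" by auto
      then have "c \<in> PiE (insert v X) L"
        by (auto simp: good_def PiE_def extensional_def Pi_def)
      then show "c \<in> {c \<in> PiE (insert v X) L. restrict c X \<in> good X}" using yg upd by auto
    next
      fix c assume c: "c \<in> {c \<in> PiE (insert v X) L. restrict c X \<in> good X}"
      then have "c = (restrict c X)(v := c v)" by (auto simp: PiE_def extensional_def restrict_def)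
      moreover have "c v \<in> L v" using c by auto
      ultimately show "c \<in> (\<lambda>(y, g). g(v := y)) ` (L v \<times> good X)"
        using c by (auto intro!: image_eqI[of _ _ "(c v, restrict c X)"])
    qed
  qed
  then have "card {c \<in> PiE (insert v X) L. restrict c X \<in> good X} = card (L v \<times> good X)"
    by (simp add: bij_betw_same_card)
  then show ?thesis using card_L assms by (simp add: card_cartesian_product)
qed

text \<open>Of the \<open>R\<close> extensions per element of \<open>good X\<close>, on average at
  most \<open>R - \<beta>\<close> create a conflict. Bounding these compares \<open>good X\<close>
  with \<open>good (X - Z)\<close>, hence the induction over all smaller sets.\<close>

lemma card_good_insert:
  fixes \<beta> :: real
  assumes \<beta>: "0 < \<beta>"
    and R: "\<And>v. v \<in> V \<Longrightarrow> \<beta> + (\<Sum>(P, Q, \<sigma>)\<in>triples_at v. (1 / \<beta>) ^ (card (P - Q) - 1)) \<le> real R"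
    and "insert v X \<subseteq> V" "v \<notin> X"
  shows "\<beta> * card (good X) \<le> card (good (insert v X))"
  using assms(3,4)
proof (induction "card X" arbitrary: X v rule: less_induct)
  case less
  have finX: "finite X" using less.prems finite_V finite_subset by auto
  \<comment> \<open>Put the vertices of \<open>Z\<close> back one at a time; each return starts from
    a set smaller than \<open>X\<close> and gains a factor \<open>\<beta>\<close>.\<close>
  have chain: "\<beta> ^ card Z * card (good (X - Z)) \<le> card (good X)" if "Z \<subseteq> X" for Z
    using finite_subset[OF that finX] that
  proof (induction Z)
    case (insert z Z)
    have eq: "insert z (X - insert z Z) = X - Z" using insert by auto
    have "\<beta> * card (good (X - insert z Z)) \<le> card (good (X - Z))"
      using less.hyps[of "X - insert z Z" z] insert.prems finX less.prems unfolding eq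
      by (metis Diff_iff Diff_subset insertI1 insert_subset psubsetI psubset_card_mono subset_trans)
    then have "\<beta> ^ card Z * (\<beta> * card (good (X - insert z Z))) \<le> \<beta> ^ card Z * card (good (X - Z))"
      using \<beta> by (intro mult_left_mono) auto
    then show ?case using insert by (simp add: mult_ac)
  qed simp
  have bad: "card (bad X v P Q \<sigma>) \<le> (1 / \<beta>) ^ (card (P - Q) - 1) * card (good X)"
    if t: "(P, Q, \<sigma>) \<in> triples" for P Q \<sigma>
  proof (cases "bad X v P Q \<sigma> = {}")
    case False
    obtain Z where Z: "Z \<subseteq> X" "card Z = card (P - Q) - 1" "card (bad X v P Q \<sigma>) \<le> card (good (X - Z))"
      using card_bad_le[OF less.prems t False] by blast
    have "real (card (good (X - Z))) = (1 / \<beta>) ^ card Z * (\<beta> ^ card Z * card (good (X - Z)))"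
      using \<beta> by (simp add: power_divide)
    also have "\<dots> \<le> (1 / \<beta>) ^ card Z * card (good X)"
      using \<beta> chain[OF Z(1)] by (intro mult_left_mono) auto
    finally show ?thesis using Z by (simp flip: Z(2))
  qed (use \<beta> in simp)
  define U where "U = (\<Union>(P, Q, \<sigma>)\<in>triples_at v. bad X v P Q \<sigma>)"
  have finU: "finite U"
    unfolding U_def by (rule finite_subset[OF _ finite_PiE_L[OF less.prems(1)]]) (auto simp: bad_def)
  have sub: "{c \<in> PiE (insert v X) L. restrict c X \<in> good X} \<subseteq> good (insert v X) \<union> U"
    using extension_good_or_bad[of _ v X] by (fastforce simp: U_def)
  have "R * card (good X) \<le> card (good (insert v X) \<union> U)"
    using card_mono[OF _ sub] finU finite_good[OF less.prems(1)] card_extensions[OF less.prems] by simp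
  also have "\<dots> \<le> card (good (insert v X)) + card U" by (rule card_Un_le)
  finally have "real R * card (good X) \<le> card (good (insert v X)) + real (card U)"
    by (metis of_nat_add of_nat_le_iff of_nat_mult)
  moreover have "real (card U) \<le> (\<Sum>(P, Q, \<sigma>)\<in>triples_at v. (1 / \<beta>) ^ (card (P - Q) - 1)) * card (good X)"
  proof -
    have "real (card U) \<le> real (\<Sum>t\<in>triples_at v. card (case t of (P, Q, \<sigma>) \<Rightarrow> bad X v P Q \<sigma>))"
      unfolding U_def of_nat_le_iff by (rule card_UN_le[OF finite_triples_at])
    also have "\<dots> \<le> (\<Sum>(P, Q, \<sigma>)\<in>triples_at v. (1 / \<beta>) ^ (card (P - Q) - 1) * card (good X))"
      unfolding of_nat_sum using bad by (intro sum_mono) (auto simp: triples_at_def)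
    finally show ?thesis by (simp add: sum_distrib_right case_prod_unfold)
  qed
  moreover have "(\<beta> + (\<Sum>(P, Q, \<sigma>)\<in>triples_at v. (1 / \<beta>) ^ (card (P - Q) - 1))) * card (good X)
      \<le> real R * card (good X)"
    using R[of v] less.prems by (intro mult_right_mono) auto
  ultimately show ?case by (simp add: distrib_right)
qed

lemma good_nonempty:
  fixes \<beta> :: real
  assumes \<beta>: "0 < \<beta>"
    and R: "\<And>v. v \<in> V \<Longrightarrow> \<beta> + (\<Sum>(P, Q, \<sigma>)\<in>triples_at v. (1 / \<beta>) ^ (card (P - Q) - 1)) \<le> real R"
  shows "good V \<noteq> {}"
proof -
  have "0 < card (good X)" if "X \<subseteq> V" for X
    using finite_subset[OF that finite_V] that
  proof (induction X)
    case empty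
    \<comment> \<open>With no vertex colored, a conflict would match every vertex with itself and
      force \<open>P = Q\<close>.\<close>
    have "\<not> conflict {} c P Q \<sigma>" if t: "(P, Q, \<sigma>) \<in> triples" for c P Q \<sigma>
    proof
      assume cf: "conflict {} c P Q \<sigma>"
      have PQ: "P \<in> E" "Q \<in> E" "\<sigma> \<in> \<P>" "P \<noteq> Q" using t by (auto simp: triples_def)
      have "P = s P ` \<sigma> ` {1..k}"
        using enum[OF PQ(1)] permutes_image[OF perm[OF PQ(3)]] by (simp add: bij_betw_def)
      also have "\<dots> = s Q ` {1..k}"
        using cf by (force simp: conflict_def image_image)
      also have "\<dots> = Q" using enum[OF PQ(2)] by (simp add: bij_betw_def)
      finally show False using PQ by simp
    qed
    then have "good {} = {\<lambda>_. undefined}" by (auto simp: good_def)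
    then show ?case by simp
  next
    case (insert v X)
    then have "0 < \<beta> * card (good X)" using \<beta> by simp
    then show ?case using card_good_insert[OF \<beta> R, of v X] insert by simp
  qed
  then show ?thesis by force
qed

lemma good_distinguishing:
  assumes "\<phi> \<in> good V"
  shows "distinguishing k \<P> E s \<phi>"
  unfolding distinguishing_def compatible_def
proof (intro ballI impI notI)
  fix P Q assume PQ: "P \<in> E" "Q \<in> E" "P \<noteq> Q" "P \<inter> Q \<noteq> {}"
    and "\<exists>\<sigma>\<in>\<P>. \<forall>j\<in>{1..k}. \<phi> (s P (\<sigma> j)) = \<phi> (s Q j)"
  then obtain \<sigma> where \<sigma>: "\<sigma> \<in> \<P>" "\<And>j. j \<in> {1..k} \<Longrightarrow> \<phi> (s P (\<sigma> j)) = \<phi> (s Q j)" by blast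
  have "s P (\<sigma> j) \<in> V \<and> s Q j \<in> V" if "j \<in> {1..k}" for j
    using that enum[OF PQ(1)] enum[OF PQ(2)] edge_subset PQ permutes_in_image[OF perm[OF \<sigma>(1)]]
    by (meson bij_betwE subsetD)
  then have "conflict V \<phi> P Q \<sigma>" using \<sigma> by (simp add: conflict_def)
  then show False using assms PQ \<sigma> by (auto simp: good_def triples_def)
qed

section \<open>Number of conflicts through a vertex\<close>

text \<open>Double counting of the pairs \<open>(u, Q)\<close> with
  \<open>u \<in> P \<inter> Q\<close>: each \<open>Q\<close> occurs \<open>k - i\<close> times, and
  each of the \<open>k\<close> vertices of \<open>P\<close> lies in at most
  \<open>\<Delta> - 1\<close> edges other than \<open>P\<close>.\<close>

lemma card_neighbours_le:
  assumes P: "P \<in> E"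
  shows "(k - i) * card {Q. Q \<in> E \<and> P \<noteq> Q \<and> card (P \<inter> Q) = k - i} \<le> k * (\<Delta> - 1)"
proof -
  let ?N = "{Q. Q \<in> E \<and> P \<noteq> Q \<and> card (P \<inter> Q) = k - i}"
  have fin: "finite ?N" using finite_E by simp
  have "(k - i) * card ?N = (\<Sum>Q\<in>?N. card {u\<in>P. u \<in> Q})"
    by (simp add: Int_def[symmetric] Collect_conj_eq)
  also have "\<dots> = (\<Sum>u\<in>P. card {Q\<in>?N. u \<in> Q})"
    using sum_multicount_gen[of P ?N "\<lambda>u Q. u \<in> Q" "\<lambda>Q. card {u\<in>P. u \<in> Q}"]
      fin finite_edge[OF P] by simp
  also have "\<dots> \<le> (\<Sum>u\<in>P. \<Delta> - 1)"
  proof (rule sum_mono)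
    fix u assume u: "u \<in> P"
    then have uV: "u \<in> V" using edge_subset P by auto
    have "card {Q\<in>?N. u \<in> Q} \<le> card ({Q \<in> E. u \<in> Q} - {P})"
      using finite_E by (intro card_mono) auto
    also have "\<dots> = card {Q \<in> E. u \<in> Q} - 1" using u P by (simp add: card_Diff_singleton)
    also have "\<dots> \<le> \<Delta> - 1" using degree_le[OF uV] by simp
    finally show "card {Q\<in>?N. u \<in> Q} \<le> \<Delta> - 1" .
  qed
  finally show ?thesis using card_edge[OF P] by simp
qed

text \<open>There are at most \<open>\<Delta>\<close> choices for \<open>P\<close>, then
  \<open>k * (\<Delta> - 1) / (k - i)\<close> for \<open>Q\<close> by the double counting, and
  \<open>card \<P>\<close> for \<open>\<sigma>\<close>.\<close>

lemma card_triples_at_le: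
  assumes v: "v \<in> V" and i: "1 \<le> i" "i < k"
  shows "real (card {(P, Q, \<sigma>) \<in> triples_at v. card (P - Q) = i})
    \<le> real \<Delta> * (real \<Delta> - 1) * card \<P> * (real k / (real k - real i))"
\<comment> \<open>\<open>real \<Delta> - 1\<close> agrees with the truncated difference only for
  \<open>\<Delta> \<ge> 1\<close>, which an edge through \<open>v\<close> guarantees.\<close>
proof (cases "{P \<in> E. v \<in> P} = {}")
  case True
  then have "{(P, Q, \<sigma>) \<in> triples_at v. card (P - Q) = i} = {}"
    by (auto simp: triples_at_def triples_def)
  moreover have "0 \<le> real \<Delta> * (real \<Delta> - 1)" by (cases \<Delta>) auto
  ultimately show ?thesis using i by (simp only: card.empty) simp
next
  case False
  then have "0 < card {P \<in> E. v \<in> P}" using finite_E by (simp add: card_gt_0_iff)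
  then have \<Delta>: "1 \<le> \<Delta>" using degree_le[OF v] by simp
  define N where "N P = {Q. Q \<in> E \<and> P \<noteq> Q \<and> card (P \<inter> Q) = k - i}" for P
  have finN: "finite (N P)" for P using finite_E by (simp add: N_def)
  have "card {(P, Q, \<sigma>) \<in> triples_at v. card (P - Q) = i} \<le> card (SIGMA P:{P \<in> E. v \<in> P}. N P \<times> \<P>)"
  proof (rule card_mono)
    show "finite (SIGMA P:{P \<in> E. v \<in> P}. N P \<times> \<P>)" using finite_E finN finite_perms by auto
    show "{(P, Q, \<sigma>) \<in> triples_at v. card (P - Q) = i} \<subseteq> (SIGMA P:{P \<in> E. v \<in> P}. N P \<times> \<P>)"
      using card_edge_diff(2) by (auto simp: triples_at_def N_def) (auto simp: triples_def)
  qed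
  also have "\<dots> = (\<Sum>P\<in>{P \<in> E. v \<in> P}. card (N P) * card \<P>)"
    using finite_E finN finite_perms by (simp add: card_cartesian_product)
  finally have "real (card {(P, Q, \<sigma>) \<in> triples_at v. card (P - Q) = i})
    \<le> (\<Sum>P\<in>{P \<in> E. v \<in> P}. real (card (N P)) * card \<P>)"
    by (simp flip: of_nat_mult of_nat_sum)
  also have "\<dots> \<le> (\<Sum>P\<in>{P \<in> E. v \<in> P}. (real k * (real \<Delta> - 1) / (real k - real i)) * card \<P>)"
  proof (intro sum_mono mult_right_mono)
    fix P assume "P \<in> {P \<in> E. v \<in> P}"
    then have "real ((k - i) * card (N P)) \<le> real (k * (\<Delta> - 1))"
      using card_neighbours_le[of P i] unfolding N_def of_nat_le_iff by blast
    then show "real (card (N P)) \<le> real k * (real \<Delta> - 1) / (real k - real i)"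
      using i \<Delta> by (simp add: of_nat_diff field_simps)
  qed simp
  also have "\<dots> = real (card {P \<in> E. v \<in> P}) * ((real k * (real \<Delta> - 1) / (real k - real i)) * card \<P>)"
    by simp
  also have "\<dots> \<le> real \<Delta> * ((real k * (real \<Delta> - 1) / (real k - real i)) * card \<P>)"
    using degree_le[OF v] i \<Delta> by (intro mult_right_mono) auto
  finally show ?thesis by (simp add: mult_ac)
qed

lemma sum_triples_at_le:
  fixes A :: "nat \<Rightarrow> real"
  assumes x: "0 \<le> x" and v: "v \<in> V"
    and A: "\<And>i. i \<in> diff_sizes k E \<Longrightarrow>
      real \<Delta> * (real \<Delta> - 1) * card \<P> * (real k / (real k - real i)) \<le> A i"
  shows "(\<Sum>(P, Q, \<sigma>)\<in>triples_at v. x ^ (card (P - Q) - 1)) \<le> (\<Sum>i\<in>diff_sizes k E. A i * x ^ (i - 1))"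
proof -
  define d :: "'a set \<times> 'a set \<times> (nat \<Rightarrow> nat) \<Rightarrow> nat" where "d = (\<lambda>(P, Q, \<sigma>). card (P - Q))"
  have fin: "finite (diff_sizes k E)" by (simp add: diff_sizes_def)
  have sub: "d ` triples_at v \<subseteq> diff_sizes k E"
    using card_edge_diff(1) by (auto simp: d_def triples_at_def diff_sizes_def) (auto simp: triples_def)
  have "(\<Sum>(P, Q, \<sigma>)\<in>triples_at v. x ^ (card (P - Q) - 1)) = (\<Sum>t\<in>triples_at v. x ^ (d t - 1))"
    by (simp add: d_def case_prod_unfold)
  also have "\<dots> = (\<Sum>i\<in>diff_sizes k E. \<Sum>t\<in>{t \<in> triples_at v. d t = i}. x ^ (d t - 1))"
    by (rule sum.group[OF finite_triples_at fin sub, symmetric])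
  also have "\<dots> = (\<Sum>i\<in>diff_sizes k E. real (card {t \<in> triples_at v. d t = i}) * x ^ (i - 1))"
    by (intro sum.cong) auto
  also have "\<dots> \<le> (\<Sum>i\<in>diff_sizes k E. A i * x ^ (i - 1))"
  proof (intro sum_mono mult_right_mono)
    fix i assume i: "i \<in> diff_sizes k E"
    then have "1 \<le> i" "i < k" by (auto simp: diff_sizes_def)
    moreover have "{t \<in> triples_at v. d t = i} = {(P, Q, \<sigma>) \<in> triples_at v. card (P - Q) = i}"
      by (auto simp: d_def)
    ultimately show "real (card {t \<in> triples_at v. d t = i}) \<le> A i"
      using card_triples_at_le[OF v, of i] A[OF i] by simp
  qed (use x in simp)
  finally show ?thesis .
qed

end

section \<open>From the bound on \<open>R\<close> to an admissible growth rate\<close>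

theorem theorem4p7:
  fixes V :: "'a set" and E :: "'a set set" and s :: "'a set \<Rightarrow> nat \<Rightarrow> 'a"
    and L :: "'a \<Rightarrow> 'c set" and \<P> :: "(nat \<Rightarrow> nat) set"
    and k \<Delta> R :: nat and I :: "nat set"
  assumes "k \<ge> 2"
    and "finite V"
    and "sequence_hypergraph V E s"
    and "uniform k E"
    and "max_degree V E \<le> \<Delta>"
    and "diff_sizes k E = I"
    and "\<And>v. v \<in> V \<Longrightarrow> infinite (L v) \<or> card (L v) \<ge> R"
    and "\<And>\<sigma>. \<sigma> \<in> \<P> \<Longrightarrow> \<sigma> permutes {1..k}"
    and "\<And>\<sigma>. \<sigma> \<in> \<P> \<Longrightarrow> inv \<sigma> \<in> \<P>"
    and "int R \<ge> 1 + \<lfloor>\<Sum>i\<in>I. q i *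
           root i (real \<Delta> * (real \<Delta> - 1) * real (card \<P>) *
             (1 + (real k - 1) * min 1 (real (card I) / (real k - real i))))\<rfloor>"
  shows "\<exists>\<phi>. list_coloring V L \<phi> \<and> distinguishing k \<P> E s \<phi>"
proof -
  \<comment> \<open>Cut every list, possibly infinite, down to exactly \<open>R\<close> colors, so
    that extensions can be counted.\<close>
  have "\<exists>S. S \<subseteq> L v \<and> finite S \<and> card S = R" if "v \<in> V" for v
    using assms(7)[OF that] by (meson infinite_arbitrarily_large obtain_subset_with_card_n)
  then obtain L' where L': "\<And>v. v \<in> V \<Longrightarrow> L' v \<subseteq> L v \<and> finite (L' v) \<and> card (L' v) = R"
    by metis
  have deg: "card {P \<in> E. v \<in> P} \<le> \<Delta>" if "v \<in> V" for v
  proof -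
    have "degree E v \<le> max_degree V E" unfolding max_degree_def
      using assms(2) that by (intro Max_ge) auto
    then show ?thesis using assms(5) by (simp add: degree_def)
  qed
  interpret list_sequence_hypergraph V E s L' \<P> k \<Delta> R
    using assms(2-4,8,9) L' deg
    by unfold_locales (auto simp: sequence_hypergraph_def uniform_def)
  define A where "A i = real \<Delta> * (real \<Delta> - 1) * real (card \<P>) *
    (1 + (real k - 1) * min 1 (real (card I) / (real k - real i)))" for i
  have I: "1 \<le> i" "i < k" "1 \<le> card I" if "i \<in> I" for i
  proof -
    have "finite I" using assms(6) by (auto simp: diff_sizes_def)
    then show "1 \<le> card I" using that by (simp add: Suc_le_eq card_gt_0_iff) blast
    show "1 \<le> i" "i < k" using that assms(6) by (auto simp: diff_sizes_def)
  qed
  have \<Delta>0: "0 \<le> real \<Delta> * (real \<Delta> - 1) * real (card \<P>)" by (cases \<Delta>) auto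
  \<comment> \<open>Two bounds on \<open>k / (k - i)\<close> meet in the minimum:
    \<open>k \<le> (k - i) + (k - 1)\<close> and \<open>k - i \<ge> 1\<close>, both from
    \<open>i < k\<close>. The numerator 1 then grows to \<open>card I\<close>, as \<open>I\<close>
    contains \<open>i\<close>.\<close>
  have A: "real \<Delta> * (real \<Delta> - 1) * card \<P> * (real k / (real k - real i)) \<le> A i" if "i \<in> I" for i
  proof -
    have ki: "1 \<le> real k - real i" "real k - real i \<le> real k - 1" "1 \<le> real (card I)"
      using I[OF that] by linarith+
    have "real k / (real k - real i) \<le> (real k - real i + (real k - 1)) / (real k - real i)"
      using ki by (intro divide_right_mono) auto
    also have "\<dots> = 1 + (real k - 1) * (1 / (real k - real i))"
      using ki unfolding add_divide_distrib by simp
    finally have "real k / (real k - real i) \<le> 1 + (real k - 1) * (1 / (real k - real i))" .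
    moreover have "real k / (real k - real i) \<le> 1 + (real k - 1) * 1"
      using ki divide_left_mono[of 1 "real k - real i" "real k"] by simp
    ultimately have "real k / (real k - real i) \<le> 1 + (real k - 1) * min 1 (1 / (real k - real i))"
      unfolding min_def by (cases "1 \<le> 1 / (real k - real i)") (simp_all only: if_True if_False)
    also have "\<dots> \<le> 1 + (real k - 1) * min 1 (real (card I) / (real k - real i))"
      using ki by (intro add_left_mono mult_left_mono min.mono divide_right_mono) auto
    finally show ?thesis unfolding A_def using \<Delta>0 by (rule mult_left_mono)
  qed
  have A0: "0 \<le> A i" if "i \<in> I" for i
    by (rule order_trans[OF mult_nonneg_nonneg[OF \<Delta>0] A[OF that]]) (use I[OF that] in simp)
  \<comment> \<open>\<open>1 + floor x\<close> exceeds \<open>x\<close> strictly, which provides the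
    positive slack for \<open>\<beta>\<close>.\<close>
  have "(\<Sum>i\<in>I. q i * root i (A i)) < real R"
    using assms(10) unfolding A_def[symmetric] by linarith
  moreover have "finite I" using assms(6) by (auto simp: diff_sizes_def)
  ultimately obtain \<beta> where \<beta>: "0 < \<beta>" "\<beta> + (\<Sum>i\<in>I. A i * (1 / \<beta>) ^ (i - 1)) \<le> real R"
    using growth_rate_exists[of I A "real R"] I A0 by blast
  have "\<beta> + (\<Sum>(P, Q, \<sigma>)\<in>triples_at v. (1 / \<beta>) ^ (card (P - Q) - 1)) \<le> real R" if "v \<in> V" for v
    using sum_triples_at_le[of "1 / \<beta>" v A] \<beta> A assms(6) that by force
  then obtain \<phi> where \<phi>: "\<phi> \<in> good V" using good_nonempty[OF \<beta>(1)] by blast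
  then have "list_coloring V L \<phi>"
    using L' by (fastforce simp: list_coloring_def good_def)
  then show ?thesis using good_distinguishing[OF \<phi>] by blast
qed

end
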